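(* Let $K$ be an algebraically closed field of characteristic other than $2$ and let $\mathfrak p$ be the Poincaré algebra over $K$. For $\lambda\in K^\times$, $v_0\in K^4$ and $x_0\in\mathrm{GL}_4(K)$ such that $\mathrm{Ad}(x_0)\in\mathrm{Aut}(\mathfrak o_4(K))$, define $f_{\lambda,v_0,x_0}\colon\mathfrak p\to\mathfrak p$ by $$f_{\lambda,v_0,x_0}\begin{pmatrix}0&v\\0&x\end{pmatrix}:=\begin{pmatrix}0&\lambda vx_0^{-1}+v_0x_0xx_0^{-1}\\0&x_0xx_0^{-1}\end{pmatrix}.$$ Then $$\mathrm{Aut}(\mathfrak p)=\{f_{\lambda,v_0,x_0}:\lambda\in K^\times,\ v_0\in K^4,\ x_0\in \mathrm{GL}_4(K),\ \mathrm{Ad}(x_0)\in\mathrm{Aut}(\mathfrak o_4(K))\}.$$ Moreover these elements satisfy $$f_{\lambda,v_0,x_0}\,f_{\mu,v_1,x_1}=f_{\lambda\mu,\ \lambda v_1x_0^{-1}+v_0,\ x_0x_1},\qquad f_{\lambda,v_0,x_0}^{-1}=f_{\lambda^{-1},\ -\lambda^{-1}v_0x_0,\ x_0^{-1}}.$$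
   Context: $\mathfrak o_4(K)$ is the Lie algebra of skew-symmetric $4\times4$ matrices over $K$. Vectors in $K^4$ are row vectors. For $x_0\in\mathrm{GL}_4(K)$, $\mathrm{Ad}(x_0)$ is the map $x\mapsto x_0xx_0^{-1}$; the condition $\mathrm{Ad}(x_0)\in\mathrm{Aut}(\mathfrak o_4(K))$ means that it maps $\mathfrak o_4(K)$ onto itself. The Poincaré algebra is $$\mathfrak p=\left\{\begin{pmatrix}0&v\\0&M\end{pmatrix}: v\in K^4,\ M\in\mathfrak o_4(K)\right\},\qquad \left[\begin{pmatrix}0&v\\0&M\end{pmatrix},\begin{pmatrix}0&v'\\0&M'\end{pmatrix}\right]=\begin{pmatrix}0&vM'-v'M\\0&[M,M']\end{pmatrix}.$$ $\mathrm{Aut}(\mathfrak p)$ is the group of Lie $K$-algebra automorphisms of $\mathfrak p$, with composition of maps. *)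

theory Defs
  imports "HOL-Analysis.Determinants" "HOL-Algebra.Bij" "HOL-Computational_Algebra.Polynomial"
begin

section \<open>Lie algebras of square matrices and their automorphism groups\<close>

definition lie_bracket :: "'k::comm_ring_1^'n^'n \<Rightarrow> 'k^'n^'n \<Rightarrow> 'k^'n^'n"
  where "lie_bracket A B = A ** B - B ** A"

definition mat_scale :: "'k::comm_ring_1 \<Rightarrow> 'k^'n^'m \<Rightarrow> 'k^'n^'m"
  where "mat_scale c A = map_matrix (\<lambda>a. c * a) A"

definition lie_subalgebra :: "('k::comm_ring_1^'n^'n) set \<Rightarrow> bool"
  where "lie_subalgebra L \<longleftrightarrow> 0 \<in> L \<and>
    (\<forall>A\<in>L. \<forall>B\<in>L. A + B \<in> L \<and> lie_bracket A B \<in> L) \<and> (\<forall>c. \<forall>A\<in>L. mat_scale c A \<in> L)"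

text \<open>As for \<open>Bij\<close> and \<open>BijGroup\<close>, self-maps of \<open>L\<close> are extensional functions,
  so that equality of maps is equality on \<open>L\<close>.\<close>

definition lie_auto :: "('k::comm_ring_1^'n^'n) set \<Rightarrow> ('k^'n^'n \<Rightarrow> 'k^'n^'n) set"
  where "lie_auto L = {f \<in> Bij L.
    (\<forall>A\<in>L. \<forall>B\<in>L. f (A + B) = f A + f B) \<and>
    (\<forall>c. \<forall>A\<in>L. f (mat_scale c A) = mat_scale c (f A)) \<and>
    (\<forall>A\<in>L. \<forall>B\<in>L. f (lie_bracket A B) = lie_bracket (f A) (f B))}"

definition lie_AutoGroup :: "('k::comm_ring_1^'n^'n) set \<Rightarrow> ('k^'n^'n \<Rightarrow> 'k^'n^'n) monoid"
  where "lie_AutoGroup L = BijGroup L \<lparr>carrier := lie_auto L\<rparr>"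

lemma subgroup_lie_auto:
  assumes L: "lie_subalgebra L"
  shows "subgroup (lie_auto L) (BijGroup L)"
proof (rule subgroup.intro)
  show "lie_auto L \<subseteq> carrier (BijGroup L)"
    by (auto simp: lie_auto_def BijGroup_def)
next
  fix f g assume fg: "f \<in> lie_auto L" "g \<in> lie_auto L"
  then have B: "f \<in> Bij L" "g \<in> Bij L" by (auto simp: lie_auto_def)
  have gL: "g A \<in> L" if "A \<in> L" for A
    using Bij_imp_funcset[OF B(2)] that by auto
  have "compose L f g \<in> lie_auto L"
    using fg L B gL by (simp add: lie_auto_def compose_Bij compose_eq lie_subalgebra_def)
  then show "f \<otimes>\<^bsub>BijGroup L\<^esub> g \<in> lie_auto L"
    using B by (simp add: BijGroup_def)
next
  show "\<one>\<^bsub>BijGroup L\<^esub> \<in> lie_auto L"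
    using L by (auto simp: BijGroup_def lie_auto_def id_Bij lie_subalgebra_def)
next
  fix f assume f: "f \<in> lie_auto L"
  then have B: "f \<in> Bij L" by (simp add: lie_auto_def)
  let ?g = "inv_into L f"
  have gL: "?g A \<in> L" if "A \<in> L" for A by (rule Bij_inv_into_mem[OF B that])
  have fg: "f (?g A) = A" if "A \<in> L" for A
    using B that by (auto simp: Bij_def bij_betw_def intro!: f_inv_into_f)
  have g: "?g A = C" if "C \<in> L" "f C = A" for A C
    using B that by (auto simp: Bij_def bij_betw_def)
  have "?g (A + B) = ?g A + ?g B \<and> ?g (lie_bracket A B) = lie_bracket (?g A) (?g B)"
    if "A \<in> L" "B \<in> L" for A B
    using f L that gL fg by (intro conjI g) (auto simp: lie_auto_def lie_subalgebra_def)
  moreover have "?g (mat_scale c A) = mat_scale c (?g A)" if "A \<in> L" for c A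
    using f L that gL fg by (intro g) (auto simp: lie_auto_def lie_subalgebra_def)
  ultimately show "inv\<^bsub>BijGroup L\<^esub> f \<in> lie_auto L"
    using L restrict_inv_into_Bij[OF B]
    by (simp add: inv_BijGroup[OF B] lie_auto_def lie_subalgebra_def)
qed

lemma group_lie_AutoGroup: "lie_subalgebra L \<Longrightarrow> group (lie_AutoGroup L)"
  by (simp add: lie_AutoGroup_def subgroup.subgroup_is_group subgroup_lie_auto group_BijGroup)


section \<open>The Poincare algebra\<close>

definition skew_matrices :: "('k::comm_ring_1^'n^'n) set"
  where "skew_matrices = {M. transpose M = - M}"

abbreviation o4 :: "('k::comm_ring_1^4^4) set"
  where "o4 \<equiv> skew_matrices"

definition Ad :: "'k::comm_ring_1^'n^'n \<Rightarrow> 'k^'n^'n \<Rightarrow> 'k^'n^'n"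
  where "Ad g x = g ** x ** matrix_inv g"

definition Ad_stabilizer :: "('k::comm_ring_1^'n^'n) set \<Rightarrow> ('k^'n^'n) set"
  where "Ad_stabilizer L = {g. invertible g \<and> Ad g ` L = L}"

lemma matrix_inv_mult:
  assumes "invertible g"
  shows "g ** matrix_inv g = mat 1 \<and> matrix_inv g ** g = mat 1"
  using assms unfolding invertible_def matrix_inv_def by (rule someI_ex)

lemma matrix_inv_unique':
  fixes A B :: "'k::comm_ring_1^'n^'n"
  assumes "A ** B = mat 1" "B ** A = mat 1"
  shows "matrix_inv A = B"
proof -
  have "invertible A" using assms by (auto simp: invertible_def)
  then have "matrix_inv A = matrix_inv A ** (A ** B)" "matrix_inv A ** A = mat 1"
    using assms matrix_inv_mult[of A] by simp_all
  then show ?thesis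
    by (simp add: matrix_mul_assoc)
qed

lemma Ad_stabilizer_mult:
  assumes "g \<in> Ad_stabilizer L" "h \<in> Ad_stabilizer L"
  shows "g ** h \<in> Ad_stabilizer L"
proof -
  have gh: "invertible g" "invertible h" "Ad g ` L = L" "Ad h ` L = L"
    using assms by (auto simp: Ad_stabilizer_def)
  let ?k = "matrix_inv h ** matrix_inv g"
  have "g ** h ** ?k = g ** (h ** matrix_inv h) ** matrix_inv g"
    by (simp only: matrix_mul_assoc)
  then have 1: "g ** h ** ?k = mat 1"
    by (simp add: matrix_inv_mult gh)
  have "?k ** (g ** h) = matrix_inv h ** (matrix_inv g ** g) ** h"
    by (simp only: matrix_mul_assoc)
  then have 2: "?k ** (g ** h) = mat 1"
    by (simp add: matrix_inv_mult gh)
  have "Ad (g ** h) = Ad g \<circ> Ad h"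
    by (auto simp: Ad_def matrix_inv_unique'[OF 1 2] matrix_mul_assoc)
  then have "Ad (g ** h) ` L = L"
    using gh by (metis image_comp)
  moreover have "invertible (g ** h)"
    using 1 2 unfolding invertible_def by blast
  ultimately show ?thesis
    by (simp add: Ad_stabilizer_def)
qed

lemma Ad_stabilizer_inv:
  assumes "g \<in> Ad_stabilizer L"
  shows "matrix_inv g \<in> Ad_stabilizer L"
proof -
  have g: "invertible g" "Ad g ` L = L"
    using assms by (auto simp: Ad_stabilizer_def)
  note i = matrix_inv_mult[OF g(1)]
  have ii: "matrix_inv (matrix_inv g) = g"
    using i by (intro matrix_inv_unique') auto
  have "Ad (matrix_inv g) (Ad g x) = x" for x
  proof -
    have "Ad (matrix_inv g) (Ad g x) = (matrix_inv g ** g) ** x ** (matrix_inv g ** g)"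
      by (simp only: Ad_def ii matrix_mul_assoc)
    then show ?thesis using i by simp
  qed
  then have "Ad (matrix_inv g) ` Ad g ` L = L"
    by (simp add: image_image)
  moreover have "invertible (matrix_inv g)"
    using i unfolding invertible_def by blast
  ultimately show ?thesis
    using g by (simp add: Ad_stabilizer_def)
qed

text \<open>Rows and columns of block matrices are indexed by the five-element type \<open>1 + 4\<close>.
  The first index is \<open>Inl 1\<close>.\<close>

definition block :: "'k::comm_ring_1^4 \<Rightarrow> 'k^4^4 \<Rightarrow> 'k^(1 + 4)^(1 + 4)"
  where "block v M = (\<chi> i j. case j of Inl _ \<Rightarrow> 0
    | Inr l \<Rightarrow> (case i of Inl _ \<Rightarrow> v $ l | Inr k \<Rightarrow> M $ k $ l))"

definition block_row :: "'k^(1 + 4)^(1 + 4) \<Rightarrow> 'k^4"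
  where "block_row X = (\<chi> l. X $ Inl 1 $ Inr l)"

definition block_mat :: "'k^(1 + 4)^(1 + 4) \<Rightarrow> 'k^4^4"
  where "block_mat X = (\<chi> k l. X $ Inr k $ Inr l)"

definition poincare :: "('k::comm_ring_1^(1 + 4)^(1 + 4)) set"
  where "poincare = {block v M | v M. M \<in> o4}"

definition poincare_map ::
    "'k::comm_ring_1 \<Rightarrow> 'k^4 \<Rightarrow> 'k^4^4 \<Rightarrow> 'k^(1 + 4)^(1 + 4) \<Rightarrow> 'k^(1 + 4)^(1 + 4)"
  where "poincare_map c v\<^sub>0 x\<^sub>0 = (\<lambda>X \<in> poincare.
    block (c *s (block_row X v* matrix_inv x\<^sub>0) + v\<^sub>0 v* (x\<^sub>0 ** block_mat X ** matrix_inv x\<^sub>0))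
      (x\<^sub>0 ** block_mat X ** matrix_inv x\<^sub>0))"

lemma block_row_block [simp]: "block_row (block v M) = v"
  by (simp add: block_row_def block_def vec_eq_iff)

lemma block_mat_block [simp]: "block_mat (block v M) = M"
  by (simp add: block_mat_def block_def vec_eq_iff)

lemma poincare_map_block:
  assumes "x \<in> o4"
  shows "poincare_map c v\<^sub>0 x\<^sub>0 (block v x) =
    block (c *s (v v* matrix_inv x\<^sub>0) + v\<^sub>0 v* (x\<^sub>0 ** x ** matrix_inv x\<^sub>0)) (x\<^sub>0 ** x ** matrix_inv x\<^sub>0)"
proof -
  have "block v x \<in> poincare" using assms by (auto simp: poincare_def)
  then show ?thesis by (simp add: poincare_map_def)
qed

lemma sum_UNIV_Plus:
  "(\<Sum>i\<in>(UNIV :: ('a::finite + 'b::finite) set). f i) = (\<Sum>a\<in>UNIV. f (Inl a)) + (\<Sum>b\<in>UNIV. f (Inr b))"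
  by (subst UNIV_Plus_UNIV [symmetric], subst sum.Plus) auto

lemma block_nth [simp]:
  "block v M $ i $ Inl a = 0" "block v M $ Inl a $ Inr l = v $ l" "block v M $ Inr k $ Inr l = M $ k $ l"
  by (simp_all add: block_def)

lemma block_mult: "block v M ** block v' M' = block (v v* M') (M ** M')"
proof -
  have "(block v M ** block v' M') $ i $ j = block (v v* M') (M ** M') $ i $ j" for i j
    by (cases i; cases j)
      (simp_all only: matrix_matrix_mult_def vector_matrix_mult_def vec_lambda_beta sum_UNIV_Plus
        block_nth mult_zero_left mult_zero_right sum.neutral_const add_0_left)
  then show ?thesis
    by (simp add: vec_eq_iff)
qed

lemma block_diff: "block v M - block v' M' = block (v - v') (M - M')"
  by (simp add: vec_eq_iff split_sum_all)

lemma lie_bracket_block: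
  "lie_bracket (block v M) (block v' M') = block (v v* M' - v' v* M) (lie_bracket M M')"
  by (simp add: lie_bracket_def block_mult block_diff)

lemma block_add: "block v M + block v' M' = block (v + v') (M + M')"
  by (simp add: vec_eq_iff split_sum_all)

lemma block_scale: "mat_scale c (block v M) = block (c *s v) (mat_scale c M)"
  by (simp add: vec_eq_iff split_sum_all mat_scale_def)

lemma block_0: "block 0 0 = 0"
  by (simp add: vec_eq_iff split_sum_all)

lemma lie_subalgebra_skew_matrices: "lie_subalgebra (skew_matrices :: ('k::comm_ring_1^'n^'n) set)"
proof -
  have "lie_bracket A B \<in> skew_matrices" if "A \<in> skew_matrices" "B \<in> skew_matrices" for A B :: "'k^'n^'n"
  proof -
    have t: "transpose A = - A" "transpose B = - B"
      using that by (auto simp: skew_matrices_def)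
    have neg: "(- P) ** (- Q) = P ** Q" for P Q :: "'k^'n^'n"
      by (simp add: vec_eq_iff matrix_matrix_mult_def)
    have "transpose (A ** B) = B ** A" "transpose (B ** A) = A ** B"
      by (simp_all add: matrix_transpose_mul t neg)
    moreover have "transpose (P - Q) = transpose P - transpose Q" for P Q :: "'k^'n^'n"
      by (simp add: transpose_def vec_eq_iff)
    ultimately show ?thesis
      by (simp add: skew_matrices_def lie_bracket_def)
  qed
  moreover have "transpose (0 :: 'k^'n^'n) = 0"
    by (simp add: transpose_def vec_eq_iff)
  moreover have "transpose (A + B) = transpose A + transpose B" for A B :: "'k^'n^'n"
    by (simp add: transpose_def vec_eq_iff)
  moreover have "transpose (mat_scale c A) = mat_scale c (transpose A)" "mat_scale c (- A) = - mat_scale c A"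
    for c and A :: "'k^'n^'n"
    by (simp_all add: transpose_def vec_eq_iff mat_scale_def)
  ultimately show ?thesis
    by (simp add: lie_subalgebra_def skew_matrices_def)
qed

lemma lie_subalgebra_poincare: "lie_subalgebra (poincare :: ('k::comm_ring_1^(1 + 4)^(1 + 4)) set)"
proof -
  have L: "lie_subalgebra (o4 :: ('k^4^4) set)"
    by (rule lie_subalgebra_skew_matrices)
  have mem: "block v M \<in> poincare" if "M \<in> o4" for v and M :: "'k^4^4"
    using that by (auto simp: poincare_def)
  have "0 \<in> (poincare :: ('k^(1 + 4)^(1 + 4)) set)"
    using mem[of 0 0] L by (simp add: lie_subalgebra_def block_0)
  moreover have "A + B \<in> poincare \<and> lie_bracket A B \<in> poincare"
    if AB: "A \<in> poincare" "B \<in> poincare" for A B :: "'k^(1 + 4)^(1 + 4)"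
  proof -
    obtain v M w N where "A = block v M" "M \<in> o4" "B = block w N" "N \<in> o4"
      using AB unfolding poincare_def by blast
    with L mem show ?thesis
      by (simp add: lie_subalgebra_def lie_bracket_block block_add)
  qed
  moreover have "mat_scale c A \<in> poincare" if A: "A \<in> poincare" for c and A :: "'k^(1 + 4)^(1 + 4)"
  proof -
    obtain v M where "A = block v M" "M \<in> o4"
      using A unfolding poincare_def by blast
    with L mem show ?thesis
      by (simp add: lie_subalgebra_def block_scale)
  qed
  ultimately show ?thesis
    by (simp add: lie_subalgebra_def)
qed

lemma group_Aut_poincare: "group (lie_AutoGroup poincare)"
  by (rule group_lie_AutoGroup [OF lie_subalgebra_poincare])

end

theory Submission
  imports Defs
begin

text \<open>The translations \<open>block v 0\<close> are exactly the elements \<open>X\<close> with \<open>[X, [Y, [X, Z]]] = 0\<close> for all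
  \<open>Y\<close> and \<open>Z\<close>, because a skew matrix \<open>x\<close> with \<open>x y x = 0\<close> for all skew \<open>y\<close> vanishes in characteristic
  other than 2. So an automorphism \<open>f\<close> restricts to a linear bijection \<open>v \<mapsto> v A\<close> on translations, and
  compatibility with \<open>[block v 0, block 0 x] = block (v x) 0\<close> forces \<open>f\<close> to induce \<open>Ad (A\<^sup>-\<^sup>1)\<close> on \<open>o4\<close>.
  The remaining translation part of \<open>f\<close> is a 1-cocycle on \<open>o4\<close> with values in its natural
  module, which is inner, and this provides \<open>v\<^sub>0\<close>. In particular \<open>\<lambda> = 1\<close> suffices, as scalars can be absorbed
  into \<open>x\<^sub>0\<close>.\<close>

section \<open>Elementary skew matrices and their brackets\<close>

text \<open>As the difference of two matrix units this is e_i wedge e_j. It vanishes for i = j, so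
  sums over all ordered pairs need no side condition.\<close>

definition skew_unit :: "'n \<Rightarrow> 'n \<Rightarrow> 'k::comm_ring_1^'n^'n"
  where "skew_unit i j = (\<chi> a b. of_bool (a = i \<and> b = j) - of_bool (a = j \<and> b = i))"

lemma skew_unit_in_skew_matrices: "skew_unit i j \<in> skew_matrices"
proof -
  have "transpose (skew_unit i j) $ a $ b = (- skew_unit i j) $ a $ b" for a b
    by (simp add: skew_unit_def transpose_def conj_commute)
  then show ?thesis unfolding skew_matrices_def mem_Collect_eq vec_eq_iff by blast
qed

lemma skew_unit_swap: "skew_unit i j = - skew_unit j i"
  by (simp add: skew_unit_def vec_eq_iff)

lemma skew_unit_same [simp]: "skew_unit i i = 0"
  by (simp add: skew_unit_def vec_eq_iff)

lemma vector_skew_unit_mult_nth: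
  "(v v* skew_unit i j) $ l = v $ i * of_bool (l = j) - v $ j * of_bool (l = i)"
proof -
  have "(\<Sum>a\<in>UNIV. v $ a * of_bool (a = i \<and> l = j)) = v $ i * of_bool (l = j)"
    "(\<Sum>a\<in>UNIV. v $ a * of_bool (a = j \<and> l = i)) = v $ j * of_bool (l = i)"
    by (simp_all add: of_bool_conj sum.delta flip: mult.assoc)
  then show ?thesis
    by (simp add: vector_matrix_mult_def skew_unit_def right_diff_distrib sum_subtractf mult.commute)
qed

lemma row_matrix_mult: "(A ** B) $ i = (A $ i) v* (B :: 'k::comm_ring_1^'n^'m)"
  by (simp add: matrix_matrix_mult_def vector_matrix_mult_def vec_eq_iff mult.commute)

text \<open>Row \<open>a\<close> of a product is row \<open>a\<close> of the left factor times the
  right factor, which \<open>vector_skew_unit_mult_nth\<close> evaluates. No indices are assumed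
  distinct, so one formula serves both bracket relations below.\<close>

lemma lie_bracket_skew_unit_nth:
  "lie_bracket (skew_unit i j) (skew_unit k l) $ a $ b =
    (of_bool (a = i \<and> k = j) - of_bool (a = j \<and> k = i)) * of_bool (b = l) -
    (of_bool (a = i \<and> l = j) - of_bool (a = j \<and> l = i)) * of_bool (b = k) -
    (of_bool (a = k \<and> i = l) - of_bool (a = l \<and> i = k)) * of_bool (b = j) +
    (of_bool (a = k \<and> j = l) - of_bool (a = l \<and> j = k)) * of_bool (b = i)"
  by (simp only: lie_bracket_def vector_minus_component row_matrix_mult vector_skew_unit_mult_nth)
    (simp add: skew_unit_def)

lemma lie_bracket_skew_unit:
  assumes "i \<noteq> j" "j \<noteq> k" "i \<noteq> k"
  shows "lie_bracket (skew_unit i j) (skew_unit j k) = skew_unit i k"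
  using assms by (simp add: vec_eq_iff lie_bracket_skew_unit_nth of_bool_conj mult_ac) (simp add: skew_unit_def of_bool_conj)

lemma lie_bracket_skew_unit_disjoint:
  assumes "{i, j} \<inter> {k, l} = {}"
  shows "lie_bracket (skew_unit i j) (skew_unit k l) = 0"
proof -
  have "i \<noteq> k" "i \<noteq> l" "j \<noteq> k" "j \<noteq> l"
    using assms by auto
  then show ?thesis by (simp add: vec_eq_iff lie_bracket_skew_unit_nth)
qed

lemma skew_matrices_nth: "x \<in> skew_matrices \<Longrightarrow> x $ i $ j = - x $ j $ i"
proof -
  assume "x \<in> skew_matrices"
  then have "transpose x $ j $ i = (- x) $ j $ i"
    by (simp add: skew_matrices_def)
  then show ?thesis by (simp add: transpose_def)
qed

lemma skew_matrices_diag: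
  fixes x :: "'k::field^'n^'n"
  assumes "(2::'k) \<noteq> 0" "x \<in> skew_matrices"
  shows "x $ i $ i = 0"
proof -
  have "2 * x $ i $ i = 0"
    using skew_matrices_nth[OF assms(2), of i i] unfolding eq_neg_iff_add_eq_0 mult_2 .
  with assms(1) show ?thesis by simp
qed

text \<open>An unordered pair of indices occurs twice in the sum, and both occurrences agree because
  coefficient and matrix change sign together; hence the division by 2. This reduces linear
  identities on skew matrices to the elementary ones.\<close>

lemma skew_matrix_eq_sum_skew_unit:
  fixes x :: "'k::field^'n^'n"
  assumes "(2::'k) \<noteq> 0" "x \<in> skew_matrices"
  shows "x = (\<Sum>i\<in>UNIV. \<Sum>j\<in>UNIV. mat_scale (x $ i $ j / 2) (skew_unit i j))"
proof -
  have "(\<Sum>i\<in>UNIV. \<Sum>j\<in>UNIV. mat_scale (x $ i $ j / 2) (skew_unit i j)) $ a $ b = x $ a $ b" for a b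
  proof -
    have "(\<Sum>i\<in>UNIV. \<Sum>j\<in>UNIV. mat_scale (x $ i $ j / 2) (skew_unit i j)) $ a $ b
      = (\<Sum>i\<in>UNIV. \<Sum>j\<in>UNIV. (if i = a then if j = b then x $ i $ j / 2 else 0 else 0))
       - (\<Sum>i\<in>UNIV. \<Sum>j\<in>UNIV. (if i = b then if j = a then x $ i $ j / 2 else 0 else 0))"
      unfolding sum_subtractf[symmetric] sum_component
      by (intro sum.cong refl) (auto simp: mat_scale_def skew_unit_def)
    also have "\<dots> = x $ a $ b / 2 - x $ b $ a / 2"
    proof -
      have "(\<Sum>i\<in>UNIV. \<Sum>j\<in>UNIV. (if i = a then if j = b then x $ i $ j / 2 else 0 else 0)) = x $ a $ b / 2"
        for a b
      proof -
        have "(\<Sum>j\<in>UNIV. (if i = a then if j = b then x $ i $ j / 2 else 0 else 0)) = (if i = a then x $ i $ b / 2 else 0)" for i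
          by simp
        then show ?thesis by simp
      qed
      then show ?thesis by (simp only:)
    qed
    also have "\<dots> = x $ a $ b"
      using assms(1) skew_matrices_nth[OF assms(2), of b a] by (simp add: field_simps)
    finally show ?thesis .
  qed
  then show ?thesis by (simp add: vec_eq_iff)
qed

lemma skew_matrix_sandwich_eq_0:
  fixes x :: "'k::field^'n^'n"
  assumes two: "(2::'k) \<noteq> 0" and x: "x \<in> skew_matrices"
    and zero: "\<And>y. y \<in> skew_matrices \<Longrightarrow> x ** y ** x = 0"
  shows "x = 0"
proof -
  have "x $ p $ q = 0" for p q
  proof -
    \<comment> \<open>The test matrix is y = \<open>skew_unit q p\<close>. Since x_pp = 0, row p of
      x y is x_pq e_p, so the (p, q) entry of x y x is the square of x_pq.\<close>
    have "x $ p v* skew_unit q p = x $ p $ q *s axis p 1"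
      using skew_matrices_diag[OF two x, of p]
      by (auto simp: vec_eq_iff vector_skew_unit_mult_nth axis_def)
    moreover have "(x $ p v* skew_unit q p) v* x = 0"
      using zero[OF skew_unit_in_skew_matrices, of q p]
      by (metis row_matrix_mult zero_index)
    ultimately have "((x $ p $ q *s axis p 1) v* x) $ q = 0"
      by simp
    moreover have "((x $ p $ q *s axis p 1) v* x) $ q = (\<Sum>i\<in>UNIV. if i = p then x $ p $ q * x $ p $ q else 0)"
      unfolding vector_matrix_mult_def vec_lambda_beta by (intro sum.cong) (auto simp: axis_def)
    ultimately show ?thesis by simp
  qed
  then show ?thesis by (simp add: vec_eq_iff)
qed

section \<open>One-cocycles of \<open>o4\<close> in its natural module\<close>

lemma sum_closed_mem:
  assumes "0 \<in> S" "\<And>x y. x \<in> S \<Longrightarrow> y \<in> S \<Longrightarrow> x + y \<in> S" "\<And>i. i \<in> I \<Longrightarrow> f i \<in> S"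
  shows "sum f I \<in> S"
  using assms(3) by (induction I rule: infinite_finite_induct) (auto intro: assms(1,2))

text \<open>On \<open>e_i \<and> e_j\<close> the cocycle takes values in the span of \<open>e_i\<close> and \<open>e_j\<close>, since it commutes
  with \<open>e_k \<and> e_l\<close> for disjoint indices. The bracket of \<open>e_i \<and> e_j\<close> and \<open>e_j \<and> e_k\<close> then shows
  that the \<open>e_j\<close>-coefficient depends only on \<open>i\<close>, and these coefficients form \<open>u\<close>.\<close>

lemma o4_cocycle_inner:
  fixes D :: "'k::field^4^4 \<Rightarrow> 'k^4"
  assumes two: "(2::'k) \<noteq> 0"
    and add: "\<And>x y. x \<in> o4 \<Longrightarrow> y \<in> o4 \<Longrightarrow> D (x + y) = D x + D y"
    and scale: "\<And>c x. x \<in> o4 \<Longrightarrow> D (mat_scale c x) = c *s D x"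
    and cocycle: "\<And>x y. x \<in> o4 \<Longrightarrow> y \<in> o4 \<Longrightarrow> D (lie_bracket x y) = D x v* y - D y v* x"
  shows "\<exists>u. \<forall>x\<in>o4. D x = u v* x"
proof -
  have o4: "0 \<in> (o4 :: ('k^4^4) set)" "\<And>x y :: 'k^4^4. x \<in> o4 \<Longrightarrow> y \<in> o4 \<Longrightarrow> x + y \<in> o4"
      "\<And>c (x :: 'k^4^4). x \<in> o4 \<Longrightarrow> mat_scale c x \<in> o4"
    using lie_subalgebra_skew_matrices[where 'n = 4 and 'k = 'k] by (auto simp: lie_subalgebra_def)
  have D0: "D 0 = 0"
    using add[of 0 0] o4 by simp
  define d where "d i j = D (skew_unit i j)" for i j
  note mem = skew_unit_in_skew_matrices
  have anti: "d i j = - d j i" for i j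
  proof -
    have "skew_unit i j + skew_unit j i = (0 :: 'k^4^4)"
      by (subst skew_unit_swap) simp
    then show ?thesis
      using add[OF mem mem, of i j j i] D0 by (simp add: d_def eq_neg_iff_add_eq_0)
  qed
  have off: "d i j $ k = 0" if "i \<noteq> k" "j \<noteq> k" for i j k
  proof -
    \<comment> \<open>Among four indices some l avoids i, j and k. In the cocycle identity for the
      commuting elements e_i wedge e_j and e_k wedge e_l, coordinate l is \<open>d i j $ k\<close>
      on one side and 0 on the other.\<close>
    have "card {i, j, k} < card (UNIV :: 4 set)"
      by (rule le_less_trans[OF card_insert_le_m1[of 3]]) (auto simp: card_insert_if)
    then have "{i, j, k} \<noteq> UNIV" by auto
    then obtain l where l: "l \<noteq> i" "l \<noteq> j" "l \<noteq> k" by blast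
    have "d i j v* skew_unit k l = d k l v* skew_unit i j"
      using cocycle[OF mem mem, of i j k l] that l D0
      by (simp add: lie_bracket_skew_unit_disjoint d_def)
    then have "(d i j v* skew_unit k l) $ l = (d k l v* skew_unit i j) $ l" by simp
    then show ?thesis using that l by (simp add: vector_skew_unit_mult_nth)
  qed
  have step: "d i k $ k = d i j $ j" if "i \<noteq> j" "j \<noteq> k" "i \<noteq> k" for i j k
  proof -
    have "d i k = d i j v* skew_unit j k - d j k v* skew_unit i j"
      using cocycle[OF mem mem, of i j j k] that by (simp add: lie_bracket_skew_unit d_def)
    then show ?thesis using that by (simp add: vector_skew_unit_mult_nth)
  qed
  \<comment> \<open>By \<open>step\<close> any index other than i gives the same value;
    \<open>i + 1\<close> is such an index, as addition on the index type is modulo 4.\<close>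
  define u where "u = (\<chi> i. d i (i + 1) $ (i + 1))"
  have u: "d i k $ k = u $ i" if "i \<noteq> k" for i k
    using step[of i "i + 1" k] that by (cases "k = i + 1") (auto simp: u_def)
  have d: "d i j = u v* skew_unit i j" for i j
  proof (cases "i = j")
    case True
    then show ?thesis by (simp add: d_def D0)
  next
    case False
    \<comment> \<open>Coordinate j is u_i, coordinate i is -u_j by antisymmetry of \<open>d\<close>,
      and the others vanish by \<open>off\<close>.\<close>
    have "d i j $ l = (u v* skew_unit i j) $ l" for l
      using False u[of i j] u[of j i] anti[of i j] off[of i l j]
      by (auto simp: vector_skew_unit_mult_nth)
    then show ?thesis by (simp add: vec_eq_iff)
  qed
  let ?S = "{x \<in> o4. D x = u v* x}"
  have S0: "0 \<in> ?S" using o4 D0 by simp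
  have Sadd: "x + y \<in> ?S" if "x \<in> ?S" "y \<in> ?S" for x y
    using that o4 add by (simp add: vector_matrix_mult_add_rdistrib)
  have Sunit: "mat_scale c (skew_unit i j) \<in> ?S" for c i j
  proof -
    have "u v* mat_scale c x = c *s (u v* x)" for x :: "'k^4^4"
      by (simp add: vec_eq_iff vector_matrix_mult_def mat_scale_def sum_distrib_left ac_simps)
    then show ?thesis
      using d[of i j] by (simp add: o4(3) mem scale d_def)
  qed
  have "x \<in> ?S" if "x \<in> o4" for x
    by (subst skew_matrix_eq_sum_skew_unit[OF two that]) (intro sum_closed_mem S0 Sadd Sunit)
  then show ?thesis by blast
qed

section \<open>Composition, inversion and bracket compatibility of the maps
  \<open>poincare_map\<close>\<close>

lemma Ad_mem: "g \<in> Ad_stabilizer L \<Longrightarrow> x \<in> L \<Longrightarrow> g ** x ** matrix_inv g \<in> L"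
  by (force simp: Ad_stabilizer_def Ad_def)

lemma Ad_stabilizer_invertible: "g \<in> Ad_stabilizer L \<Longrightarrow> invertible g"
  by (simp add: Ad_stabilizer_def)

lemma matrix_inv_matrix_mul:
  fixes A B :: "'k::comm_ring_1^'n^'n"
  assumes "invertible A" "invertible B"
  shows "matrix_inv (A ** B) = matrix_inv B ** matrix_inv A"
proof (rule matrix_inv_unique')
  have "A ** B ** (matrix_inv B ** matrix_inv A) = A ** (B ** matrix_inv B) ** matrix_inv A"
    by (simp only: matrix_mul_assoc)
  then show "A ** B ** (matrix_inv B ** matrix_inv A) = mat 1"
    by (simp add: matrix_inv_mult assms)
  have "matrix_inv B ** matrix_inv A ** (A ** B) = matrix_inv B ** (matrix_inv A ** A) ** B"
    by (simp only: matrix_mul_assoc)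
  then show "matrix_inv B ** matrix_inv A ** (A ** B) = mat 1"
    by (simp add: matrix_inv_mult assms)
qed

lemma block_in_poincare [simp]: "block v x \<in> poincare \<longleftrightarrow> x \<in> o4"
  by (auto simp: poincare_def) (metis block_mat_block)

lemma poincareE:
  assumes "X \<in> poincare"
  obtains v x where "X = block v x" "x \<in> o4"
  using assms by (auto simp: poincare_def)

lemma block_eq_iff: "block v x = block w y \<longleftrightarrow> v = w \<and> x = y"
  by (metis block_mat_block block_row_block)

lemma poincare_map_in_poincare:
  assumes "g \<in> Ad_stabilizer o4" "X \<in> poincare"
  shows "poincare_map c v g X \<in> poincare"
  using assms by (auto elim!: poincareE simp: poincare_map_block Ad_mem)

text \<open>The pointwise form is available before these maps are known to be automorphisms: it
  first yields their bijectivity and later the group law.\<close>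

lemma poincare_map_comp:
  fixes c d :: "'k::field"
  assumes g: "g \<in> Ad_stabilizer o4" and h: "h \<in> Ad_stabilizer o4" and X: "X \<in> poincare"
  shows "poincare_map c v g (poincare_map d w h X) =
    poincare_map (c * d) (c *s (w v* matrix_inv g) + v) (g ** h) X"
proof -
  obtain u x where X: "X = block u x" "x \<in> o4"
    using X by (rule poincareE)
  let ?g = "matrix_inv g" and ?h = "matrix_inv h"
  have inv: "matrix_inv (g ** h) = ?h ** ?g"
    using g h by (simp add: matrix_inv_matrix_mul Ad_stabilizer_invertible)
  \<comment> \<open>This cancellation turns the contribution of \<open>w\<close>, conjugated by
    \<open>h\<close> and then multiplied by the inverse of \<open>g\<close>, into w g^-1 times the
    full conjugate of x under \<open>g ** h\<close>.\<close>
  have "?g ** (g ** h ** x ** ?h ** ?g) = (?g ** g) ** (h ** x ** ?h ** ?g)"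
    by (simp only: matrix_mul_assoc)
  then have "?g ** (g ** h ** x ** ?h ** ?g) = h ** x ** ?h ** ?g"
    by (simp add: matrix_inv_mult Ad_stabilizer_invertible[OF g])
  then show ?thesis
    using X g h
    by (simp add: poincare_map_block Ad_mem inv block_eq_iff matrix_mul_assoc vector_matrix_mul_assoc
        vector_matrix_left_distrib scalar_vector_matrix_assoc vector_add_ldistrib vector_smult_assoc)
qed

lemma matrix_inv_mat_1 [simp]: "matrix_inv (mat 1 :: 'k::comm_ring_1^'n^'n) = mat 1"
  by (rule matrix_inv_unique') simp_all

lemma poincare_map_1: "X \<in> poincare \<Longrightarrow> poincare_map 1 0 (mat 1) X = X"
  by (auto elim!: poincareE simp: poincare_map_block)

lemma matrix_inv_matrix_inv:
  fixes A :: "'k::comm_ring_1^'n^'n"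
  shows "invertible A \<Longrightarrow> matrix_inv (matrix_inv A) = A"
  by (rule matrix_inv_unique') (use matrix_inv_mult in blast)+

text \<open>The translation parameter solves c w g^-1 + v = 0 for w, so both composites have
  parameters 1, 0 and \<open>mat 1\<close>.\<close>

lemma
  fixes c :: "'k::field"
  assumes c: "c \<noteq> 0" and g: "g \<in> Ad_stabilizer o4" and X: "X \<in> poincare"
  shows poincare_map_left_inverse:
      "poincare_map (inverse c) (- (inverse c *s (v v* g))) (matrix_inv g) (poincare_map c v g X) = X"
    and poincare_map_right_inverse:
      "poincare_map c v g (poincare_map (inverse c) (- (inverse c *s (v v* g))) (matrix_inv g) X) = X"
proof -
  note inv = Ad_stabilizer_inv[OF g] matrix_inv_mult[OF Ad_stabilizer_invertible[OF g]]
    matrix_inv_matrix_inv[OF Ad_stabilizer_invertible[OF g]]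
  have neg: "(- y) v* A = - (y v* A)" for y :: "'k^4" and A :: "'k^4^4"
    by (simp add: vector_matrix_mult_def vec_eq_iff sum_negf)
  show "poincare_map (inverse c) (- (inverse c *s (v v* g))) (matrix_inv g) (poincare_map c v g X) = X"
    using c by (simp add: poincare_map_comp g X inv poincare_map_1)
  have "c *s ((- (inverse c *s (v v* g))) v* matrix_inv g) = - v"
    using c by (simp add: neg scalar_vector_matrix_assoc vector_matrix_mul_assoc inv vector_smult_assoc)
  then show "poincare_map c v g (poincare_map (inverse c) (- (inverse c *s (v v* g))) (matrix_inv g) X) = X"
    using c by (simp add: poincare_map_comp g X inv poincare_map_1)
qed

lemma Ad_lie_bracket:
  fixes g :: "'k::comm_ring_1^'n^'n"
  assumes "invertible g"
  shows "g ** lie_bracket x y ** matrix_inv g =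
    lie_bracket (g ** x ** matrix_inv g) (g ** y ** matrix_inv g)"
proof -
  have "g ** (x ** y) ** matrix_inv g = (g ** x ** matrix_inv g) ** (g ** y ** matrix_inv g)" for x y
  proof -
    have "(g ** x ** matrix_inv g) ** (g ** y ** matrix_inv g) =
        g ** x ** (matrix_inv g ** g) ** y ** matrix_inv g"
      by (simp only: matrix_mul_assoc)
    then show ?thesis
      by (simp add: matrix_inv_mult assms matrix_mul_assoc)
  qed
  moreover have "A ** (B - C) = A ** B - A ** C" "(B - C) ** A = B ** A - C ** A" for A B C :: "'k^'n^'n"
    by (simp_all add: vec_eq_iff matrix_matrix_mult_def algebra_simps sum_subtractf)
  ultimately show ?thesis
    by (simp add: lie_bracket_def)
qed

text \<open>Scaling translations and conjugating by g respect the bracket. The extra term, the fixed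
  vector v times the conjugate of x, is an inner cocycle and therefore respects it too.\<close>

lemma poincare_map_in_lie_auto:
  fixes c :: "'k::field"
  assumes c: "c \<noteq> 0" and g: "g \<in> Ad_stabilizer o4"
  shows "poincare_map c v g \<in> lie_auto poincare"
proof -
  let ?f = "poincare_map c v g" and ?g = "matrix_inv g"
  have "bij_betw ?f poincare poincare"
    by (rule bij_betw_byWitness[where f' = "poincare_map (inverse c) (- (inverse c *s (v v* g))) ?g"])
      (auto simp: poincare_map_left_inverse poincare_map_right_inverse c g poincare_map_in_poincare
        Ad_stabilizer_inv)
  then have "?f \<in> Bij poincare"
    by (simp add: Bij_def poincare_map_def)
  moreover have "?f (A + B) = ?f A + ?f B \<and> ?f (lie_bracket A B) = lie_bracket (?f A) (?f B)"
    if AB: "A \<in> poincare" "B \<in> poincare" for A B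
  proof -
    obtain u x w y where [simp]: "A = block u x" "B = block w y" and xy: "x \<in> o4" "y \<in> o4"
      using AB by (metis poincareE)
    have mem: "x + y \<in> o4" "lie_bracket x y \<in> o4"
      using lie_subalgebra_skew_matrices[where 'k = 'k and 'n = 4] xy by (auto simp: lie_subalgebra_def)
    have "g ** (x + y) ** ?g = g ** x ** ?g + g ** y ** ?g"
      by (simp add: vec_eq_iff matrix_matrix_mult_def algebra_simps sum.distrib)
    then have "?f (A + B) = ?f A + ?f B"
      using xy mem
      by (simp add: block_add poincare_map_block block_eq_iff vector_matrix_left_distrib
          vector_matrix_mult_add_rdistrib vector_add_ldistrib)
    moreover have "?f (lie_bracket A B) = lie_bracket (?f A) (?f B)"
    proof -
      \<comment> \<open>\<open>cancel\<close> says that multiplication by the inverse of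
        \<open>g\<close> intertwines the natural action with the conjugated one;
        \<open>bracket\<close> says that matrices act on row vectors as a right representation.
        Together they match all terms.\<close>
      have cancel: "w v* ?g v* (g ** z ** ?g) = w v* z v* ?g" for w z
      proof -
        have "w v* ?g v* (g ** z ** ?g) = w v* ((?g ** g) ** z ** ?g)"
          by (simp only: vector_matrix_mul_assoc matrix_mul_assoc)
        then show ?thesis
          by (simp add: matrix_inv_mult Ad_stabilizer_invertible[OF g] vector_matrix_mul_assoc)
      qed
      have bracket: "v v* lie_bracket P Q = v v* P v* Q - v v* Q v* P" for P Q
        by (simp add: lie_bracket_def vector_matrix_mult_diff_rdistrib vector_matrix_mul_assoc)
      show ?thesis
        using xy mem
        by (simp add: lie_bracket_block poincare_map_block block_eq_iff
            Ad_lie_bracket[OF Ad_stabilizer_invertible[OF g]] bracket vector_matrix_left_distrib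
            vector_matrix_mult_diff_distrib scalar_vector_matrix_assoc cancel)
          (simp add: vec_eq_iff algebra_simps)
    qed
    ultimately show ?thesis by blast
  qed
  moreover have "?f (mat_scale a A) = mat_scale a (?f A)" if A: "A \<in> poincare" for a A
  proof -
    obtain u x where [simp]: "A = block u x" and x: "x \<in> o4"
      using A by (rule poincareE)
    have "mat_scale a x \<in> o4"
      using lie_subalgebra_skew_matrices[where 'k = 'k and 'n = 4] x by (auto simp: lie_subalgebra_def)
    moreover have "g ** mat_scale a x ** ?g = mat_scale a (g ** x ** ?g)"
      by (simp add: mat_scale_def vec_eq_iff matrix_matrix_mult_def sum_distrib_left ac_simps)
    moreover have "v v* mat_scale a z = a *s (v v* z)" for z
      by (simp add: vec_eq_iff vector_matrix_mult_def mat_scale_def sum_distrib_left ac_simps)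
    ultimately show ?thesis
      using x by (simp add: block_scale poincare_map_block block_eq_iff scalar_vector_matrix_assoc
          vector_add_ldistrib vector_smult_assoc mult.commute)
  qed
  ultimately show ?thesis
    by (simp add: lie_auto_def)
qed

section \<open>Every automorphism is a \<open>poincare_map\<close>\<close>

lemma lie_bracket_0 [simp]: "lie_bracket 0 x = 0" "lie_bracket x 0 = 0"
  by (simp_all add: lie_bracket_def)

text \<open>Translations form an abelian ideal, which gives one direction. The condition uses only
  brackets with arbitrary elements, so automorphisms preserve it.\<close>

lemma translation_characterization:
  fixes v :: "'k::field^4"
  assumes two: "(2::'k) \<noteq> 0" and x: "x \<in> o4"
  shows "x = 0 \<longleftrightarrow> (\<forall>Y\<in>poincare. \<forall>Z\<in>poincare.
    lie_bracket (block v x) (lie_bracket Y (lie_bracket (block v x) Z)) = 0)"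
    (is "_ \<longleftrightarrow> ?R")
proof
  assume "x = 0"
  then show ?R
    by (auto elim!: poincareE simp: lie_bracket_block block_0)
next
  assume R: ?R
  have "x ** y ** x = 0" if y: "y \<in> o4" for y
  proof -
    have "w v* (x ** y ** x) = 0" for w
    proof -
      \<comment> \<open>For these choices the iterated bracket is the translation by -w x y
        x.\<close>
      have "lie_bracket (block v x) (lie_bracket (block 0 y) (lie_bracket (block v x) (block w 0))) = 0"
        using R y by (simp add: lie_subalgebra_skew_matrices[unfolded lie_subalgebra_def])
      moreover have "(- u) v* A = - (u v* A)" for u :: "'k^4" and A :: "'k^4^4"
        by (simp add: vector_matrix_mult_def vec_eq_iff sum_negf)
      ultimately show ?thesis
        by (simp add: lie_bracket_block vector_matrix_mul_assoc block_eq_iff flip: block_0)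
    qed
    then have "axis i 1 v* (x ** y ** x) = 0" for i by blast
    moreover have "axis i 1 v* A = A $ i" for i and A :: "'k^4^4"
      by (simp add: vec_eq_iff vector_matrix_mult_def axis_def if_distrib[of "\<lambda>c. c * _"] cong: if_cong)
    ultimately show ?thesis by (simp add: vec_eq_iff)
  qed
  then show "x = 0"
    by (rule skew_matrix_sandwich_eq_0[OF two x])
qed

lemma lie_auto_poincare_obtains:
  fixes f :: "'k::field^(1 + 4)^(1 + 4) \<Rightarrow> 'k^(1 + 4)^(1 + 4)"
  assumes two: "(2::'k) \<noteq> 0" and f: "f \<in> lie_auto poincare"
  obtains v g where "g \<in> Ad_stabilizer o4" "f = poincare_map 1 v g"
proof -
  have Bij: "f \<in> Bij poincare"
    and add: "\<And>A B. A \<in> poincare \<Longrightarrow> B \<in> poincare \<Longrightarrow> f (A + B) = f A + f B"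
    and scale: "\<And>c A. A \<in> poincare \<Longrightarrow> f (mat_scale c A) = mat_scale c (f A)"
    and bracket: "\<And>A B. A \<in> poincare \<Longrightarrow> B \<in> poincare \<Longrightarrow>
      f (lie_bracket A B) = lie_bracket (f A) (f B)"
    using f by (auto simp: lie_auto_def)
  have inj: "inj_on f poincare" and surj: "f ` poincare = poincare"
    and ext: "f \<in> extensional poincare"
    using Bij by (auto simp: Bij_def bij_betw_def)
  have o4: "0 \<in> (o4 :: ('k^4^4) set)" "\<And>x y :: 'k^4^4. x \<in> o4 \<Longrightarrow> y \<in> o4 \<Longrightarrow> x + y \<in> o4"
      "\<And>x y :: 'k^4^4. x \<in> o4 \<Longrightarrow> y \<in> o4 \<Longrightarrow> lie_bracket x y \<in> o4"
      "\<And>c (x :: 'k^4^4). x \<in> o4 \<Longrightarrow> mat_scale c x \<in> o4"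
    using lie_subalgebra_skew_matrices[where 'n = 4 and 'k = 'k] by (auto simp: lie_subalgebra_def)
  have closed: "f X \<in> poincare" if "X \<in> poincare" for X
    using surj that by blast
  have p: "lie_bracket A B \<in> poincare" if "A \<in> poincare" "B \<in> poincare" for A B :: "'k^(1 + 4)^(1 + 4)"
    using lie_subalgebra_poincare[where 'k = 'k] that by (auto simp: lie_subalgebra_def)
  have f0: "f 0 = 0"
    using add[of 0 0] lie_subalgebra_poincare[where 'k = 'k] by (simp add: lie_subalgebra_def)

  define \<phi> where "\<phi> v = block_row (f (block v 0))" for v
  define \<delta> where "\<delta> x = block_row (f (block 0 x))" for x
  define \<sigma> where "\<sigma> x = block_mat (f (block 0 x))" for x
  have f_transl: "f (block v 0) = block (\<phi> v) 0" for v
  proof -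
    have "f (block v 0) \<in> poincare" by (simp add: closed o4)
    then obtain w y where wy: "f (block v 0) = block w y" "y \<in> o4" by (rule poincareE)
    have "lie_bracket (block w y) (lie_bracket Y (lie_bracket (block w y) Z)) = 0"
      if "Y \<in> poincare" "Z \<in> poincare" for Y Z
    proof -
      \<comment> \<open>The condition on the image has to be tested against all of
        \<open>poincare\<close>; by surjectivity every test element is itself an image, so the
        condition on \<open>block v 0\<close> applies.\<close>
      have "Y \<in> f ` poincare" "Z \<in> f ` poincare"
        using that by (simp_all only: surj)
      then obtain Y' Z' where YZ: "Y = f Y'" "Z = f Z'" "Y' \<in> poincare" "Z' \<in> poincare"
        by blast
      have "lie_bracket (block w y) (lie_bracket Y (lie_bracket (block w y) Z)) =
          f (lie_bracket (block v 0) (lie_bracket Y' (lie_bracket (block v 0) Z')))"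
        using YZ by (simp add: wy(1)[symmetric] bracket p o4)
      also have "\<dots> = 0"
        using translation_characterization[OF two o4(1), of v] YZ f0 by simp
      finally show ?thesis .
    qed
    then have "y = 0"
      using translation_characterization[OF two wy(2), of w] by blast
    then show ?thesis by (simp add: wy \<phi>_def)
  qed
  have f_rot: "f (block 0 x) = block (\<delta> x) (\<sigma> x)" and \<sigma>: "\<sigma> x \<in> o4" if "x \<in> o4" for x
  proof -
    have "f (block 0 x) \<in> poincare" using that by (simp add: closed)
    then obtain w y where "f (block 0 x) = block w y" "y \<in> o4" by (rule poincareE)
    then show "f (block 0 x) = block (\<delta> x) (\<sigma> x)" "\<sigma> x \<in> o4" by (simp_all add: \<delta>_def \<sigma>_def)
  qed
  have f_block: "f (block v x) = block (\<phi> v + \<delta> x) (\<sigma> x)" if "x \<in> o4" for v x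
    using add[of "block v 0" "block 0 x"] that by (simp add: block_add f_transl f_rot o4)

  have \<phi>_add: "\<phi> (v + w) = \<phi> v + \<phi> w" for v w
    using add[of "block v 0" "block w 0"] by (simp add: block_add f_transl o4 block_eq_iff)
  have \<phi>_scale: "\<phi> (c *s v) = c *s \<phi> v" for c v
  proof -
    have "mat_scale c (0 :: 'k^4^4) = 0"
      by (simp add: mat_scale_def vec_eq_iff)
    then show ?thesis
      using scale[of "block v 0" c] by (simp add: block_scale f_transl o4 block_eq_iff)
  qed
  \<comment> \<open>\<open>matrix\<close> describes an action on columns; the transpose converts it
    to row vectors.\<close>
  define A where "A = transpose (matrix \<phi>)"
  have lin: "Vector_Spaces.linear (*s) (*s) \<phi>"
    by unfold_locales (simp_all add: \<phi>_add \<phi>_scale algebra_simps)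
  have \<phi>: "\<phi> v = v v* A" for v
    by (simp add: A_def matrix_works[OF lin])
  have "inj \<phi>"
  proof (rule injI)
    fix v w assume "\<phi> v = \<phi> w"
    then have "f (block v 0) = f (block w 0)" by (simp add: f_transl)
    then have "block v 0 = block w (0 :: 'k^4^4)"
      using inj by (simp add: inj_on_def o4)
    then show "v = w" by (simp add: block_eq_iff)
  qed
  then have "inj ((*v) (matrix \<phi>))"
    by (simp add: inj_def matrix_works[OF lin])
  then obtain B where "B ** matrix \<phi> = mat 1"
    using matrix_left_invertible_injective by blast
  then have "A ** transpose B = mat 1"
    unfolding A_def by (metis matrix_transpose_mul transpose_mat)
  then have AB: "A ** transpose B = mat 1" "transpose B ** A = mat 1"
    using matrix_left_right_inverse by blast+
  \<comment> \<open>\<open>g\<close> is the inverse of A, because \<open>poincare_map\<close>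
    multiplies the translation part by the inverse of its matrix parameter.\<close>
  define g where "g = transpose B"
  have gA: "A ** g = mat 1" "g ** A = mat 1"
    using AB by (simp_all add: g_def)
  have inv_g: "matrix_inv g = A"
    by (rule matrix_inv_unique') (simp_all add: gA)

  have \<sigma>_eq: "\<sigma> x = g ** x ** A" if x: "x \<in> o4" for x
  proof -
    \<comment> \<open>Both sides are the translation part of the image of [\<open>block v 0\<close>,
      \<open>block 0 x\<close>] = \<open>block (v v* x) 0\<close>.\<close>
    have "v v* x v* A = v v* A v* \<sigma> x" for v
      using bracket[of "block v 0" "block 0 x"] x
      by (simp add: lie_bracket_block f_transl f_rot o4 block_eq_iff \<phi>)
    then have "v v* (x ** A) = v v* (A ** \<sigma> x)" for v
      by (simp add: vector_matrix_mul_assoc)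
    then have "x ** A = A ** \<sigma> x"
      by (metis matrix_eq transpose_matrix_vector transpose_transpose)
    then have "g ** x ** A = g ** A ** \<sigma> x"
      by (metis matrix_mul_assoc)
    then show ?thesis by (simp add: gA)
  qed
  have "Ad g ` o4 = o4"
  proof
    show "Ad g ` o4 \<subseteq> o4"
      using \<sigma> \<sigma>_eq by (auto simp: Ad_def inv_g)
    show "o4 \<subseteq> Ad g ` o4"
    proof
      fix y :: "'k^4^4" assume "y \<in> o4"
      then have "block 0 y \<in> f ` poincare" by (simp add: surj)
      then obtain v x where "x \<in> o4" "f (block v x) = block 0 y"
        by (auto elim: poincareE)
      then have "Ad g x = y" by (simp add: f_block block_eq_iff \<sigma>_eq Ad_def inv_g)
      with \<open>x \<in> o4\<close> show "y \<in> Ad g ` o4" by blast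
    qed
  qed
  then have g: "g \<in> Ad_stabilizer o4"
    using gA by (auto simp: Ad_stabilizer_def invertible_def)

  \<comment> \<open>\<open>\<delta>\<close> is a cocycle for the action twisted by
    \<open>\<sigma>\<close>, that is, by conjugation with \<open>g\<close>. Multiplying by
    \<open>g\<close> on the right undoes the twist, so the result on the natural module
    applies.\<close>
  have "\<exists>u. \<forall>x\<in>o4. \<delta> x v* g = u v* x"
  proof (rule o4_cocycle_inner[OF two])
    show "\<delta> (x + y) v* g = \<delta> x v* g + \<delta> y v* g" if "x \<in> o4" "y \<in> o4" for x y
      using add[of "block 0 x" "block 0 y"] that
      by (simp add: block_add f_rot o4 block_eq_iff vector_matrix_left_distrib)
    show "\<delta> (mat_scale c x) v* g = c *s (\<delta> x v* g)" if "x \<in> o4" for c x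
      using scale[of "block 0 x" c] that
      by (simp add: block_scale f_rot o4 block_eq_iff scalar_vector_matrix_assoc)
    show "\<delta> (lie_bracket x y) v* g = \<delta> x v* g v* y - \<delta> y v* g v* x" if "x \<in> o4" "y \<in> o4" for x y
    proof -
      have "\<delta> (lie_bracket x y) = \<delta> x v* \<sigma> y - \<delta> y v* \<sigma> x"
        using bracket[of "block 0 x" "block 0 y"] that
        by (simp add: lie_bracket_block f_rot o4 block_eq_iff)
      moreover have "g ** z ** A ** g = g ** z" for z
        using gA by (metis matrix_mul_assoc matrix_mul_rid)
      ultimately show ?thesis
        using that by (simp add: \<sigma>_eq vector_matrix_mult_diff_distrib vector_matrix_mul_assoc)
    qed
  qed
  then obtain u where u: "\<And>x. x \<in> o4 \<Longrightarrow> \<delta> x v* g = u v* x"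
    by blast
  \<comment> \<open>Undoing the multiplication by \<open>g\<close> gives u x A = (u A)(g x A), so
    the required vector is u A.\<close>
  have \<delta>_eq: "\<delta> x = u v* A v* (g ** x ** A)" if "x \<in> o4" for x
  proof -
    have "\<delta> x = \<delta> x v* g v* A" by (simp add: vector_matrix_mul_assoc gA)
    also have "\<dots> = u v* (A ** g ** x ** A)"
      using u[OF that] by (simp add: gA vector_matrix_mul_assoc)
    finally show ?thesis by (simp add: vector_matrix_mul_assoc matrix_mul_assoc)
  qed
  have "f = poincare_map 1 (u v* A) g"
  proof (rule extensionalityI[OF ext])
    show "poincare_map 1 (u v* A) g \<in> extensional poincare"
      by (simp add: poincare_map_def)
    fix X :: "'k^(1 + 4)^(1 + 4)" assume "X \<in> poincare"
    then obtain v x where "X = block v x" "x \<in> o4" by (rule poincareE)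
    then show "f X = poincare_map 1 (u v* A) g X"
      by (simp add: poincare_map_block f_block \<phi> \<delta>_eq \<sigma>_eq inv_g)
  qed
  with g show thesis by (rule that)
qed

section \<open>The automorphism group in characteristic other than 2\<close>

lemma CHAR_neq_2_imp_two_neq_0:
  assumes "CHAR('k::field) \<noteq> 2"
  shows "(2::'k) \<noteq> 0"
proof
  assume "(2::'k) = 0"
  then have "of_nat 2 = (0::'k)" by simp
  then have "CHAR('k) dvd 2" by (simp only: of_nat_eq_0_iff_char_dvd)
  moreover have "CHAR('k) \<noteq> 1" by simp
  ultimately show False
    using assms by (metis prime_nat_iff two_is_prime_nat)
qed

theorem proposition10:
  assumes "CHAR('k::alg_closed_field) \<noteq> 2"
  shows "carrier (lie_AutoGroup (poincare :: ('k^(1 + 4)^(1 + 4)) set)) =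
      {poincare_map c v\<^sub>0 x\<^sub>0 | c v\<^sub>0 x\<^sub>0. c \<noteq> 0 \<and> x\<^sub>0 \<in> Ad_stabilizer o4} \<and>
    (\<forall>(c::'k) d v\<^sub>0 v\<^sub>1. \<forall>x\<^sub>0 \<in> Ad_stabilizer o4. \<forall>x\<^sub>1 \<in> Ad_stabilizer o4. c \<noteq> 0 \<longrightarrow> d \<noteq> 0 \<longrightarrow>
      poincare_map c v\<^sub>0 x\<^sub>0 \<otimes>\<^bsub>lie_AutoGroup poincare\<^esub> poincare_map d v\<^sub>1 x\<^sub>1 =
        poincare_map (c * d) (c *s (v\<^sub>1 v* matrix_inv x\<^sub>0) + v\<^sub>0) (x\<^sub>0 ** x\<^sub>1)) \<and>
    (\<forall>(c::'k) v\<^sub>0. \<forall>x\<^sub>0 \<in> Ad_stabilizer o4. c \<noteq> 0 \<longrightarrow>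
      inv\<^bsub>lie_AutoGroup poincare\<^esub> (poincare_map c v\<^sub>0 x\<^sub>0) =
        poincare_map (inverse c) (- (inverse c *s (v\<^sub>0 v* x\<^sub>0))) (matrix_inv x\<^sub>0))"
proof (intro conjI allI ballI impI)
  have two: "(2::'k) \<noteq> 0"
    using assms by (rule CHAR_neq_2_imp_two_neq_0)
  have carrier: "carrier (lie_AutoGroup L) = lie_auto L" for L :: "('k^(1 + 4)^(1 + 4)) set"
    by (simp add: lie_AutoGroup_def)
  note mem = poincare_map_in_lie_auto[where 'k = 'k]
  show "carrier (lie_AutoGroup (poincare :: ('k^(1 + 4)^(1 + 4)) set)) =
      {poincare_map c v\<^sub>0 x\<^sub>0 | c v\<^sub>0 x\<^sub>0. c \<noteq> 0 \<and> x\<^sub>0 \<in> Ad_stabilizer o4}"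
    unfolding carrier
  proof (intro equalityI subsetI)
    fix f :: "'k^(1 + 4)^(1 + 4) \<Rightarrow> 'k^(1 + 4)^(1 + 4)" assume "f \<in> lie_auto poincare"
    then obtain v g where "g \<in> Ad_stabilizer o4" "f = poincare_map 1 v g"
      by (rule lie_auto_poincare_obtains[OF two])
    then show "f \<in> {poincare_map c v\<^sub>0 x\<^sub>0 | c v\<^sub>0 x\<^sub>0. c \<noteq> 0 \<and> x\<^sub>0 \<in> Ad_stabilizer o4}"
      using one_neq_zero by blast
  qed (auto simp: mem)
  have mult: "poincare_map c v g \<otimes>\<^bsub>lie_AutoGroup poincare\<^esub> poincare_map d w h =
      poincare_map (c * d) (c *s (w v* matrix_inv g) + v) (g ** h)"
    if "c \<noteq> 0" "d \<noteq> 0" "g \<in> Ad_stabilizer o4" "h \<in> Ad_stabilizer o4" for c d :: 'k and v w g h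
  proof -
    have Bij: "poincare_map c v g \<in> Bij poincare" "poincare_map d w h \<in> Bij poincare"
      using mem that by (auto simp: lie_auto_def)
    \<comment> \<open>Both sides are extensional, so the pointwise law on \<open>poincare\<close>
      gives equality of maps.\<close>
    have "compose poincare (poincare_map c v g) (poincare_map d w h) =
        poincare_map (c * d) (c *s (w v* matrix_inv g) + v) (g ** h)"
    proof (rule extensionalityI)
      show "poincare_map (c * d) (c *s (w v* matrix_inv g) + v) (g ** h) \<in> extensional poincare"
        by (simp add: poincare_map_def)
    qed (simp_all add: compose_eq poincare_map_comp that)
    with Bij show ?thesis by (simp add: lie_AutoGroup_def BijGroup_def)
  qed
  show "poincare_map c v\<^sub>0 x\<^sub>0 \<otimes>\<^bsub>lie_AutoGroup poincare\<^esub> poincare_map d v\<^sub>1 x\<^sub>1 =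
        poincare_map (c * d) (c *s (v\<^sub>1 v* matrix_inv x\<^sub>0) + v\<^sub>0) (x\<^sub>0 ** x\<^sub>1)"
    if "c \<noteq> 0" "d \<noteq> 0" "x\<^sub>0 \<in> Ad_stabilizer o4" "x\<^sub>1 \<in> Ad_stabilizer o4" for c d :: 'k and v\<^sub>0 v\<^sub>1 x\<^sub>0 x\<^sub>1
    using that by (rule mult)
  fix c :: 'k and v g
  assume c: "c \<noteq> 0" and g: "g \<in> Ad_stabilizer (o4 :: ('k^4^4) set)"
  let ?h = "poincare_map (inverse c) (- (inverse c *s (v v* g))) (matrix_inv g)"
  have inv: "inverse c \<noteq> 0" "matrix_inv g \<in> Ad_stabilizer o4"
    using c g by (simp_all add: Ad_stabilizer_inv)
  \<comment> \<open>In a group a left inverse is the inverse, so this one product suffices.\<close>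
  have "?h \<otimes>\<^bsub>lie_AutoGroup poincare\<^esub> poincare_map c v g = poincare_map 1 0 (mat 1)"
    using c g by (simp add: mult inv matrix_inv_matrix_inv Ad_stabilizer_invertible matrix_inv_mult)
  also have "\<dots> = (\<lambda>X\<in>poincare. X)"
  proof (rule extensionalityI)
    show "poincare_map 1 0 (mat 1) \<in> extensional poincare"
      by (simp add: poincare_map_def)
  qed (simp_all add: poincare_map_1)
  also have "\<dots> = \<one>\<^bsub>lie_AutoGroup poincare\<^esub>"
    by (simp add: lie_AutoGroup_def BijGroup_def)
  finally show "inv\<^bsub>lie_AutoGroup poincare\<^esub> (poincare_map c v g) = ?h"
    by (rule group.inv_equality[OF group_Aut_poincare]) (simp_all add: carrier mem c g inv)
qed

end
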